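(* Let $S\subset\,]0,+\infty[$. Then the class $\mathcal{U}^{c<}_S$ of all finite convexly ordered ultrametric spaces with distances in $S$ has the ordering property: for every finite ultrametric space $X$ with distances in $S$ there is a finite ultrametric space $Y$ with distances in $S$ such that for every convex linear ordering $<^X$ on $X$ and every convex linear ordering $<^Y$ on $Y$, there is an order-preserving isometric embedding of $(X,<^X)$ into $(Y,<^Y)$.
   Context: A metric space $X$ is ultrametric when $d^X(x,z)\leqslant\max(d^X(x,y),d^X(y,z))$ for all $x,y,z\in X$. "With distances in $S$" means that all distances between distinct points belong to $S$. A linear ordering $<$ on an ultrametric space $X$ is convex when all the metric balls of $X$ are $<$-convex. $\mathcal{U}^{c<}_S$ is the class of all pairs $(X,<^X)$ with $X$ a finite ultrametric space with distances in $S$ and $<^X$ a convex linear ordering on $X$. *)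

theory Defs
  imports "HOL-Analysis.Abstract_Metric_Spaces"
begin

locale Ultrametric_space = Metric_space +
  assumes ultrametric:
    "\<lbrakk>x \<in> M; y \<in> M; z \<in> M\<rbrakk> \<Longrightarrow> d x z \<le> max (d x y) (d y z)"

definition finite_ultrametric_with_distances_in ::
    "real set \<Rightarrow> 'a set \<Rightarrow> ('a \<Rightarrow> 'a \<Rightarrow> real) \<Rightarrow> bool" where
  "finite_ultrametric_with_distances_in S X d \<longleftrightarrow>
     finite X \<and> Ultrametric_space X d \<and> (\<forall>x\<in>X. \<forall>y\<in>X. x \<noteq> y \<longrightarrow> d x y \<in> S)"

definition order_convex_in :: "'a set \<Rightarrow> 'a rel \<Rightarrow> 'a set \<Rightarrow> bool" where
  "order_convex_in X r C \<longleftrightarrow>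
     (\<forall>x\<in>C. \<forall>y\<in>C. \<forall>z\<in>X. (x, z) \<in> r \<and> (z, y) \<in> r \<longrightarrow> z \<in> C)"

(* Orderings are the reflexive relations of linear_order_on: the strict order x < y of
   the mathematics is (x, y) \<in> r with x \<noteq> y.  Metric balls are both the open and the
   closed ones. *)
definition convex_linear_order_on ::
    "'a set \<Rightarrow> ('a \<Rightarrow> 'a \<Rightarrow> real) \<Rightarrow> 'a rel \<Rightarrow> bool" where
  "convex_linear_order_on X d r \<longleftrightarrow>
     linear_order_on X r \<and>
     (\<forall>x\<in>X. \<forall>\<epsilon>. order_convex_in X r (Metric_space.mball X d x \<epsilon>) \<and>
                order_convex_in X r (Metric_space.mcball X d x \<epsilon>))"

definition ordered_isometric_embedding ::
    "'a set \<Rightarrow> ('a \<Rightarrow> 'a \<Rightarrow> real) \<Rightarrow> 'a rel \<Rightarrow>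
     'b set \<Rightarrow> ('b \<Rightarrow> 'b \<Rightarrow> real) \<Rightarrow> 'b rel \<Rightarrow> ('a \<Rightarrow> 'b) \<Rightarrow> bool" where
  "ordered_isometric_embedding X dX rX Y dY rY f \<longleftrightarrow>
     f ` X \<subseteq> Y \<and>
     (\<forall>x\<in>X. \<forall>x'\<in>X. dY (f x) (f x') = dX x x') \<and>
     (\<forall>x\<in>X. \<forall>x'\<in>X. (f x, f x') \<in> rY \<longleftrightarrow> (x, x') \<in> rX)"

end

theory Submission
  imports Defs
begin

text \<open>
  The space \<open>Y\<close> is the set of leaves of a regular tree: if \<open>m\<^sub>1 < \<dots> < m\<^sub>n\<close> are the distances
  that occur in \<open>X\<close> and \<open>k\<close> exceeds the number of points of \<open>X\<close>, take all words of length \<open>n\<close>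
  over \<open>k\<close> letters, two words being at distance \<open>m\<^sub>i\<close> when \<open>i\<close> is the last place at which
  they differ.  A convex linear ordering of such a space amounts to a linear ordering of the
  \<open>k\<close> children of each inner node, so all convex orderings of \<open>Y\<close> look alike, namely
  lexicographic.  On the other hand a convexly ordered ultrametric space with at most \<open>k\<close> points
  and distances \<open>m\<^sub>1, \<dots>, m\<^sub>n\<close> is the set of leaves of an ordered tree with at most \<open>k\<close> children
  per node, and this fits into every ordering of the regular tree.

  Words are encoded as numbers in base \<open>k\<close>, the least significant digit belonging to the
  least distance.  The embedding is built by induction on the list of distances
  (\<open>universal_ordered_embedding\<close>).  The closed balls of radius \<open>m\<^sub>1\<close> of \<open>X\<close> are replaced by one
  representative each, which leaves the distances \<open>m\<^sub>2, \<dots>, m\<^sub>n\<close>; the representatives are embedded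
  into the words without their last digit, and every ball is then embedded, by comparing ranks,
  into the \<open>k\<close> words that lie over the image of its representative.  These local maps fit together
  because the order between points of two disjoint convex sets depends on the sets only
  (\<open>order_between_convex_sets\<close>).
\<close>

section \<open>Finite linear orders\<close>

lemma linear_order_on_linear:
  assumes "linear_order_on X r" "x \<in> X" "y \<in> X"
  shows "(x, y) \<in> r \<or> (y, x) \<in> r"
  using assms by (cases "x = y") (auto simp: order_on_defs total_on_def refl_on_def)

text \<open>If \<open>a < b\<close> but \<open>b' < a'\<close>, then either \<open>b'\<close> lies between \<open>a'\<close> and \<open>a\<close>, or \<open>a\<close> lies between
  \<open>b'\<close> and \<open>b\<close>; both contradict convexity and disjointness.\<close>

lemma order_between_convex_sets:
  assumes lin: "linear_order_on X r"
    and convex: "order_convex_in X r C" "order_convex_in X r D"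
    and "C \<subseteq> X" "D \<subseteq> X" "C \<inter> D = {}"
    and "a \<in> C" "a' \<in> C" "b \<in> D" "b' \<in> D"
    and "(a, b) \<in> r"
  shows "(a', b') \<in> r"
proof (rule ccontr)
  assume "(a', b') \<notin> r"
  note total = linear_order_on_linear[OF lin]
  have "(b', a') \<in> r"
    using total[of a' b'] \<open>(a', b') \<notin> r\<close> assms by auto
  show False
  proof (cases "(a, b') \<in> r")
    case True
    with \<open>(b', a') \<in> r\<close> have "b' \<in> C"
      using assms unfolding order_convex_in_def by blast
    with assms show False by auto
  next
    case False
    with total[of a b'] have "(b', a) \<in> r"
      using assms by auto
    with \<open>(a, b) \<in> r\<close> have "a \<in> D"
      using assms unfolding order_convex_in_def by blast
    with assms show False by auto
  qed
qed

definition rank_in :: "'a set \<Rightarrow> 'a rel \<Rightarrow> 'a \<Rightarrow> nat" where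
  "rank_in A r x = card {y \<in> A. (y, x) \<in> r}"

lemma rank_in_le_iff:
  assumes lin: "linear_order_on X r" and "A \<subseteq> X" "finite A" "x \<in> A" "y \<in> A"
  shows "rank_in A r x \<le> rank_in A r y \<longleftrightarrow> (x, y) \<in> r"
proof
  have trans: "trans r" and antisym: "antisym r"
    using lin by (auto simp: order_on_defs)
  {
    assume "(x, y) \<in> r"
    then have "{z \<in> A. (z, x) \<in> r} \<subseteq> {z \<in> A. (z, y) \<in> r}"
      using transD[OF trans] by blast
    then show "rank_in A r x \<le> rank_in A r y"
      unfolding rank_in_def using \<open>finite A\<close> by (intro card_mono) auto
  }
  assume le: "rank_in A r x \<le> rank_in A r y"
  show "(x, y) \<in> r"
  proof (rule ccontr)
    assume "(x, y) \<notin> r"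
    have "(x, x) \<in> r" "(y, x) \<in> r"
      using linear_order_on_linear[OF lin] assms \<open>(x, y) \<notin> r\<close> by blast+
    then have "{z \<in> A. (z, y) \<in> r} \<subset> {z \<in> A. (z, x) \<in> r}"
      using transD[OF trans] \<open>(x, y) \<notin> r\<close> \<open>x \<in> A\<close> by blast
    then have "rank_in A r y < rank_in A r x"
      unfolding rank_in_def using \<open>finite A\<close> by (intro psubset_card_mono) auto
    with le show False by simp
  qed
qed

lemma bij_betw_rank_in:
  assumes lin: "linear_order_on X r" and "A \<subseteq> X" "finite A"
  shows "bij_betw (rank_in A r) A {1..card A}"
proof -
  have inj: "inj_on (rank_in A r) A"
  proof (rule inj_onI)
    fix x y assume "x \<in> A" "y \<in> A" "rank_in A r x = rank_in A r y"
    then have "(x, y) \<in> r" "(y, x) \<in> r"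
      using rank_in_le_iff[OF assms, of x y] rank_in_le_iff[OF assms, of y x] by simp_all
    then show "x = y"
      using lin by (auto simp: order_on_defs dest: antisymD)
  qed
  have "rank_in A r x \<in> {1..card A}" if "x \<in> A" for x
  proof -
    have "x \<in> {y \<in> A. (y, x) \<in> r}"
      using lin that \<open>A \<subseteq> X\<close> by (auto simp: order_on_defs refl_on_def)
    then have "0 < rank_in A r x"
      unfolding rank_in_def using \<open>finite A\<close> by (subst card_gt_0_iff) auto
    moreover have "rank_in A r x \<le> card A"
      unfolding rank_in_def using \<open>finite A\<close> by (intro card_mono) auto
    ultimately show ?thesis by simp
  qed
  then have "rank_in A r ` A = {1..card A}"
    using inj by (intro card_subset_eq) (auto simp: card_image)
  with inj show ?thesis
    by (simp add: bij_betw_def)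
qed

text \<open>The two orders stay relations on the whole spaces and are only looked at on \<open>A\<close> and \<open>B\<close>,
  which will be a ball of one space and a ball of the other.\<close>

lemma finite_linear_order_embedding:
  assumes A: "linear_order_on X r" "A \<subseteq> X" "finite A"
    and B: "linear_order_on Y s" "B \<subseteq> Y" "finite B"
    and card: "card A \<le> card B"
  shows "\<exists>g. (\<forall>x\<in>A. g x \<in> B) \<and> (\<forall>x\<in>A. \<forall>y\<in>A. (g x, g y) \<in> s \<longleftrightarrow> (x, y) \<in> r)"
proof -
  define g where "g = inv_into B (rank_in B s) \<circ> rank_in A r"
  have rank_g: "g x \<in> B" "rank_in B s (g x) = rank_in A r x" if "x \<in> A" for x
  proof -
    have "rank_in A r x \<in> rank_in B s ` B"
      using bij_betwE[OF bij_betw_rank_in[OF A]] bij_betw_imp_surj_on[OF bij_betw_rank_in[OF B]]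
        that card by auto
    then show "g x \<in> B" "rank_in B s (g x) = rank_in A r x"
      unfolding g_def by (simp_all add: inv_into_into f_inv_into_f)
  qed
  have "(g x, g y) \<in> s \<longleftrightarrow> (x, y) \<in> r" if "x \<in> A" "y \<in> A" for x y
    using rank_in_le_iff[OF A that] rank_in_le_iff[OF B rank_g(1) rank_g(1), OF that]
      rank_g(2)[OF that(1)] rank_g(2)[OF that(2)] by simp
  with rank_g(1) show ?thesis by blast
qed


section \<open>Convex orderings and isometric embeddings\<close>

text \<open>The balls of \<open>X\<close> are the preimages of the balls of \<open>Y\<close> around points of the image, and
  monotone preimages of convex sets are convex.  This provides the orders to which the induction
  hypothesis of the embedding theorem is applied: on the set of representatives, and on the words
  that arise by deleting the last digit.\<close>

lemma convex_linear_order_on_pullback: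
  assumes metric: "Metric_space X d" "Metric_space Y e"
    and convex: "convex_linear_order_on Y e r"
    and h: "h ` X \<subseteq> Y"
    and isometry: "\<And>x y. x \<in> X \<Longrightarrow> y \<in> X \<Longrightarrow> e (h x) (h y) = d x y"
  shows "convex_linear_order_on X d {(x, y). x \<in> X \<and> y \<in> X \<and> (h x, h y) \<in> r}"
    (is "convex_linear_order_on X d ?r")
proof -
  have lin: "linear_order_on Y r"
    using convex by (simp add: convex_linear_order_on_def)
  have inj: "x = y" if "x \<in> X" "y \<in> X" "h x = h y" for x y
    using that h isometry[of x y] Metric_space.zero[OF metric(1), of x y]
      Metric_space.zero[OF metric(2), of "h x" "h y"] by auto
  have "linear_order_on X ?r"
    unfolding order_on_defs
  proof (intro conjI)
    show "refl_on X ?r"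
      using lin h by (auto simp: order_on_defs refl_on_def)
    show "trans ?r"
      using lin by (auto simp: order_on_defs intro!: transI dest: transD)
    show "antisym ?r"
      using lin inj by (auto simp: order_on_defs intro!: antisymI dest: antisymD)
    show "total_on X ?r"
      using linear_order_on_linear[OF lin] h by (auto simp: total_on_def image_subset_iff)
  qed auto
  moreover have "order_convex_in X ?r (Metric_space.mball X d x \<epsilon>) \<and>
      order_convex_in X ?r (Metric_space.mcball X d x \<epsilon>)" if "x \<in> X" for x \<epsilon>
  proof -
    have "h x \<in> Y"
      using that h by auto
    then have "order_convex_in Y r (Metric_space.mball Y e (h x) \<epsilon>)"
      "order_convex_in Y r (Metric_space.mcball Y e (h x) \<epsilon>)"
      using convex by (auto simp: convex_linear_order_on_def)
    moreover have "Metric_space.mball X d x \<epsilon> = {y \<in> X. h y \<in> Metric_space.mball Y e (h x) \<epsilon>}"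
      "Metric_space.mcball X d x \<epsilon> = {y \<in> X. h y \<in> Metric_space.mcball Y e (h x) \<epsilon>}"
      using that h isometry
      by (auto simp: Metric_space.mball_def[OF metric(1)] Metric_space.mball_def[OF metric(2)]
          Metric_space.mcball_def[OF metric(1)] Metric_space.mcball_def[OF metric(2)])
    ultimately show ?thesis
      using h unfolding order_convex_in_def by blast
  qed
  ultimately show ?thesis
    by (simp add: convex_linear_order_on_def)
qed

lemma (in Ultrametric_space) subspace_Ultrametric_space:
  "N \<subseteq> M \<Longrightarrow> Ultrametric_space N d"
  by (intro Ultrametric_space.intro Ultrametric_space_axioms.intro subspace)
    (auto intro: ultrametric)

text \<open>In an ultrametric space being at distance at most \<open>e\<close> is an equivalence relation, and its
  classes have well-defined distances from each other.\<close>

lemma (in Ultrametric_space) mcball_eq_mcball: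
  assumes "x \<in> M" "y \<in> M" "d x y \<le> e"
  shows "mcball x e = mcball y e"
proof -
  have "d y z \<le> e" if "z \<in> M" "d x z \<le> e" for z
    using ultrametric[of y x z] assms that by (simp add: commute[of y x])
  moreover have "d x z \<le> e" if "z \<in> M" "d y z \<le> e" for z
    using ultrametric[of x y z] assms that by simp
  ultimately show ?thesis
    using assms by auto
qed

lemma (in Ultrametric_space) dist_between_balls:
  assumes "x \<in> M" "x' \<in> M" "y \<in> M" "y' \<in> M"
    and "d x x' \<le> e" "d y y' \<le> e" "e < d x y"
  shows "d x y = d x' y'"
  using ultrametric[of x x' y] ultrametric[of x' y' y] ultrametric[of x' x y']
    ultrametric[of x y y'] assms commute[of x x'] commute[of y y']
  by (smt (verit))


section \<open>The regular ultrametric space\<close>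

text \<open>The list holds the distances in increasing order, and \<open>p div k\<close> deletes the least
  significant digit: two words get the entry of the list that belongs to the most significant
  digit at which they differ.\<close>

fun digit_dist :: "nat \<Rightarrow> real list \<Rightarrow> nat \<Rightarrow> nat \<Rightarrow> real" where
  "digit_dist k [] p q = 0"
| "digit_dist k (m # ms) p q =
    (if p = q then 0
     else if p div k = q div k then m
     else digit_dist k ms (p div k) (q div k))"

lemma digit_dist_self [simp]: "digit_dist k ms p p = 0"
  by (cases ms) auto

lemma digit_dist_commute: "digit_dist k ms p q = digit_dist k ms q p"
  by (induction ms arbitrary: p q) auto

lemma div_less_power_iff:
  "0 < (k::nat) \<Longrightarrow> p div k < k ^ n \<longleftrightarrow> p < k ^ Suc n"
  by (simp add: div_less_iff_less_mult mult.commute)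

lemma digit_dist_in_set:
  assumes "0 < k" "p < k ^ length ms" "q < k ^ length ms" "p \<noteq> q"
  shows "digit_dist k ms p q \<in> set ms"
  using assms
proof (induction ms arbitrary: p q)
  case (Cons m ms)
  then show ?case
    using div_less_power_iff[OF \<open>0 < k\<close>, of _ "length ms"] by auto
qed simp

lemma digit_dist_nonneg: "\<forall>m\<in>set ms. 0 < m \<Longrightarrow> 0 \<le> digit_dist k ms p q"
  by (induction ms arbitrary: p q) (auto intro: less_imp_le)

text \<open>Deleting the least significant digit can only turn the distance \<open>m\<close> into \<open>0\<close>.  As \<open>m\<close> is
  below all other distances, the ultrametric inequality survives when such a digit is added.\<close>

lemma digit_dist_ultrametric:
  assumes "0 < k" "sorted_wrt (<) ms" "\<forall>m\<in>set ms. 0 < m"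
    and "p < k ^ length ms" "q < k ^ length ms" "t < k ^ length ms"
  shows "digit_dist k ms p t \<le> max (digit_dist k ms p q) (digit_dist k ms q t)"
  using assms
proof (induction ms arbitrary: p q t)
  case (Cons m ms)
  have bounds: "p div k < k ^ length ms" "q div k < k ^ length ms" "t div k < k ^ length ms"
    using Cons.prems div_less_power_iff[OF \<open>0 < k\<close>, of _ "length ms"] by auto
  have above: "m \<le> digit_dist k ms u v"
    if "u < k ^ length ms" "v < k ^ length ms" "u \<noteq> v" for u v
    using digit_dist_in_set[OF \<open>0 < k\<close> that] Cons.prems by (auto intro: less_imp_le)
  have "digit_dist k ms (p div k) (t div k)
      \<le> max (digit_dist k ms (p div k) (q div k)) (digit_dist k ms (q div k) (t div k))"
    using Cons.IH[OF \<open>0 < k\<close> _ _ bounds] Cons.prems by simp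
  then show ?case
    using above[OF bounds(1,2)] above[OF bounds(2,3)] above[OF bounds(1,3)] Cons.prems
    by (auto simp: le_max_iff_disj)
qed simp

lemma Ultrametric_space_digit_dist:
  assumes "0 < k" "sorted_wrt (<) ms" "\<forall>m\<in>set ms. 0 < m"
  shows "Ultrametric_space {..<k ^ length ms} (digit_dist k ms)"
proof -
  have ultra: "digit_dist k ms p t \<le> max (digit_dist k ms p q) (digit_dist k ms q t)"
    if "p \<in> {..<k ^ length ms}" "q \<in> {..<k ^ length ms}" "t \<in> {..<k ^ length ms}" for p q t
    using digit_dist_ultrametric[OF assms] that by simp
  show ?thesis
  proof
    show "0 \<le> digit_dist k ms p q" for p q
      using assms digit_dist_nonneg by blast
    show "digit_dist k ms p q = digit_dist k ms q p" for p q
      by (rule digit_dist_commute)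
    show "digit_dist k ms p q = 0 \<longleftrightarrow> p = q"
      if "p \<in> {..<k ^ length ms}" "q \<in> {..<k ^ length ms}" for p q
      using digit_dist_in_set[OF \<open>0 < k\<close>, of p ms q] that assms by force
    show "digit_dist k ms p t \<le> digit_dist k ms p q + digit_dist k ms q t"
      if "p \<in> {..<k ^ length ms}" "q \<in> {..<k ^ length ms}" "t \<in> {..<k ^ length ms}" for p q t
      using ultra[OF that] digit_dist_nonneg[OF assms(3), of k p q]
        digit_dist_nonneg[OF assms(3), of k q t] by linarith
  qed (rule ultra)
qed

text \<open>Being balls, the sets of words that share all digits but the least significant one are convex
  in every convex ordering of the space.\<close>

lemma mcball_digit_dist:
  assumes "0 < k" "sorted_wrt (<) (m # ms)" "\<forall>l\<in>set (m # ms). 0 < l"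
    and "p < k ^ length ms"
  shows "Metric_space.mcball {..<k ^ length (m # ms)} (digit_dist k (m # ms)) (p * k) m
    = {q. q div k = p}"
proof -
  interpret Ultrametric_space "{..<k ^ length (m # ms)}" "digit_dist k (m # ms)"
    using assms by (intro Ultrametric_space_digit_dist)
  have pk: "p * k < k ^ length (m # ms)"
    using assms div_less_power_iff[OF \<open>0 < k\<close>, of "p * k" "length ms"] by simp
  show ?thesis
  proof (intro set_eqI iffI)
    fix q assume q: "q \<in> mcball (p * k) m"
    then have "q < k ^ length (m # ms)" and close: "digit_dist k (m # ms) (p * k) q \<le> m"
      unfolding in_mcball by blast+
    then have "q div k < k ^ length ms"
      using div_less_power_iff[OF \<open>0 < k\<close>, of q "length ms"] by simp
    then have "m < digit_dist k ms p (q div k)" if "p \<noteq> q div k"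
      using digit_dist_in_set[OF \<open>0 < k\<close>, of p ms "q div k"] that assms by auto
    then show "q \<in> {q. q div k = p}"
      using close \<open>0 < k\<close> by (auto split: if_splits)
  next
    fix q assume "q \<in> {q. q div k = p}"
    then show "q \<in> mcball (p * k) m"
      unfolding in_mcball
      using assms pk div_less_power_iff[OF \<open>0 < k\<close>, of q "length ms"] by auto
  qed
qed

lemma div_fibre_eq_interval:
  assumes "0 < (k::nat)"
  shows "{q. q div k = p} = {p * k..<p * k + k}"
proof (intro set_eqI iffI)
  fix q assume "q \<in> {q. q div k = p}"
  then have "q = p * k + q mod k"
    using div_mult_mod_eq[of q k] by simp
  then show "q \<in> {p * k..<p * k + k}"
    using mod_less_divisor[OF assms, of q] by simp
next
  fix q assume "q \<in> {p * k..<p * k + k}"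
  then show "q \<in> {q. q div k = p}"
    by (auto intro!: div_nat_eqI simp: mult.commute)
qed

text \<open>The induction removes the least distance \<open>m\<close>, so that a single application of the
  hypothesis, to a set of representatives of the closed balls of radius \<open>m\<close>, places all of
  these balls at once.\<close>

lemma universal_ordered_embedding:
  assumes "0 < k" "sorted_wrt (<) ms" "\<forall>m\<in>set ms. 0 < m"
    and "finite_ultrametric_with_distances_in (set ms) X d" "card X \<le> k"
    and "convex_linear_order_on X d r"
    and "convex_linear_order_on {..<k ^ length ms} (digit_dist k ms) s"
  shows "\<exists>f. ordered_isometric_embedding X d r {..<k ^ length ms} (digit_dist k ms) s f"
  using assms
proof (induction ms arbitrary: X r s)
  case Nil
  interpret Ultrametric_space X d
    using Nil.prems by (simp add: finite_ultrametric_with_distances_in_def)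
  have single: "x = y" if "x \<in> X" "y \<in> X" for x y
    using Nil.prems that by (auto simp: finite_ultrametric_with_distances_in_def)
  have "(0, 0) \<in> s" "\<And>x. x \<in> X \<Longrightarrow> (x, x) \<in> r"
    using Nil.prems by (auto simp: convex_linear_order_on_def order_on_defs refl_on_def)
  then have "ordered_isometric_embedding X d r {..<k ^ length []} (digit_dist k []) s (\<lambda>_. 0)"
    using single by (force simp: ordered_isometric_embedding_def)
  then show ?case by blast
next
  case (Cons m ms)
  let ?Y = "{..<k ^ length (m # ms)}" and ?e = "digit_dist k (m # ms)"
  let ?Y' = "{..<k ^ length ms}" and ?e' = "digit_dist k ms"
  have ms: "sorted_wrt (<) ms" "\<forall>l\<in>set ms. 0 < l" and m_less: "\<And>l. l \<in> set ms \<Longrightarrow> m < l"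
    and "0 < m"
    using Cons.prems by auto
  have "finite X" and XU: "Ultrametric_space X d"
    and dist: "\<And>x y. x \<in> X \<Longrightarrow> y \<in> X \<Longrightarrow> x \<noteq> y \<Longrightarrow> d x y \<in> set (m # ms)"
    using Cons.prems(4) by (auto simp: finite_ultrametric_with_distances_in_def)
  interpret X: Ultrametric_space X d by (rule XU)
  interpret Y: Ultrametric_space ?Y ?e
    using Cons.prems by (intro Ultrametric_space_digit_dist)
  interpret Y': Ultrametric_space ?Y' ?e'
    using ms \<open>0 < k\<close> by (intro Ultrametric_space_digit_dist)
  have rlin: "linear_order_on X r" and slin: "linear_order_on ?Y s"
    and rball: "\<And>x. x \<in> X \<Longrightarrow> order_convex_in X r (X.mcball x m)"
    and sball: "\<And>p. p \<in> ?Y \<Longrightarrow> order_convex_in ?Y s (Y.mcball p m)"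
    using Cons.prems(6,7) unfolding convex_linear_order_on_def by blast+
  have Y_iff: "p \<in> ?Y \<longleftrightarrow> p div k \<in> ?Y'" for p
    using div_less_power_iff[OF \<open>0 < k\<close>, of p "length ms"] by simp
  have fibre: "Y.mcball (p * k) m = {q. q div k = p}" if "p \<in> ?Y'" for p
    using mcball_digit_dist Cons.prems that by simp

  \<comment> \<open>The choice depends on the ball only, so all points of a ball get the same representative.\<close>
  define rep where "rep x = (SOME z. z \<in> X.mcball x m)" for x
  have rep: "rep x \<in> X.mcball x m" if "x \<in> X" for x
    unfolding rep_def by (rule someI[of _ x]) (use that \<open>0 < m\<close> in simp)
  then have rep_X: "rep x \<in> X" and rep_close: "d x (rep x) \<le> m" if "x \<in> X" for x
    using that by auto
  have rep_eq: "rep x = rep y \<longleftrightarrow> d x y \<le> m" if "x \<in> X" "y \<in> X" for x y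
  proof
    assume "rep x = rep y"
    then show "d x y \<le> m"
      using X.ultrametric[of x "rep x" y] rep_X rep_close that
      by (metis X.commute max.bounded_iff order_trans)
  next
    assume "d x y \<le> m"
    then show "rep x = rep y"
      using X.mcball_eq_mcball that by (simp add: rep_def)
  qed
  have rep_dist: "d x y = d (rep x) (rep y)" if "x \<in> X" "y \<in> X" "rep x \<noteq> rep y" for x y
    using X.dist_between_balls[of x "rep x" y "rep y" m] rep_X rep_close rep_eq that by force
  define X' where "X' = rep ` X"
  have "X' \<subseteq> X"
    using rep_X by (auto simp: X'_def)
  interpret X': Ultrametric_space X' d
    by (rule X.subspace_Ultrametric_space) fact

  define r' where "r' = {(x, y). x \<in> X' \<and> y \<in> X' \<and> (id x, id y) \<in> r}"
  define s' where "s' = {(p, q). p \<in> ?Y' \<and> q \<in> ?Y' \<and> (p * k, q * k) \<in> s}"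
  have "d x y \<in> set ms" if xy: "x \<in> X'" "y \<in> X'" "x \<noteq> y" for x y
  proof -
    obtain a b where ab: "a \<in> X" "b \<in> X" "x = rep a" "y = rep b"
      using xy by (auto simp: X'_def)
    with xy have "m < d a b" "d x y = d a b"
      using rep_eq rep_dist by force+
    then show ?thesis
      using dist[of x y] xy \<open>X' \<subseteq> X\<close> by auto
  qed
  then have X'_space: "finite_ultrametric_with_distances_in (set ms) X' d"
    using \<open>finite X\<close> X'.Ultrametric_space_axioms
    by (auto simp: finite_ultrametric_with_distances_in_def X'_def)
  have "card X' \<le> k"
    using card_mono[OF \<open>finite X\<close> \<open>X' \<subseteq> X\<close>] Cons.prems by simp
  moreover have "convex_linear_order_on X' d r'"
    unfolding r'_def
    by (rule convex_linear_order_on_pullback[OF X'.Metric_space_axioms X.Metric_space_axioms])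
      (use Cons.prems \<open>X' \<subseteq> X\<close> in auto)
  moreover have "convex_linear_order_on ?Y' ?e' s'"
    unfolding s'_def
  proof (rule convex_linear_order_on_pullback[OF Y'.Metric_space_axioms Y.Metric_space_axioms])
    show "(\<lambda>p. p * k) ` ?Y' \<subseteq> ?Y"
      using \<open>0 < k\<close> Y_iff by fastforce
    show "?e (p * k) (q * k) = ?e' p q" for p q
      using \<open>0 < k\<close> by simp
  qed (rule Cons.prems(7))
  ultimately obtain f' where "ordered_isometric_embedding X' d r' ?Y' ?e' s' f'"
    using Cons.IH[OF \<open>0 < k\<close> ms X'_space] by blast
  then have f'_in: "\<And>z. z \<in> X' \<Longrightarrow> f' z \<in> ?Y'"
    and f'_dist: "\<And>z w. z \<in> X' \<Longrightarrow> w \<in> X' \<Longrightarrow> ?e' (f' z) (f' w) = d z w"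
    and f'_order: "\<And>z w. z \<in> X' \<Longrightarrow> w \<in> X' \<Longrightarrow> (f' z, f' w) \<in> s' \<longleftrightarrow> (z, w) \<in> r'"
    by (auto simp: ordered_isometric_embedding_def)

  have "\<exists>g. (\<forall>x\<in>X.mcball z m. g x div k = f' z) \<and>
      (\<forall>x\<in>X.mcball z m. \<forall>y\<in>X.mcball z m. (g x, g y) \<in> s \<longleftrightarrow> (x, y) \<in> r)"
    if "z \<in> X'" for z
  proof -
    have ball: "X.mcball z m \<subseteq> X" "finite (X.mcball z m)"
      using \<open>finite X\<close> by (auto simp: X.mcball_def)
    have words: "{q. q div k = f' z} \<subseteq> ?Y"
      using f'_in[OF that] by (intro subsetI) (simp only: Y_iff mem_Collect_eq)
    then have words_finite: "finite {q. q div k = f' z}"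
      by (rule finite_subset) simp
    have "card (X.mcball z m) \<le> card {q. q div k = f' z}"
      using card_mono[OF \<open>finite X\<close> ball(1)] \<open>card X \<le> k\<close> by (simp add: div_fibre_eq_interval[OF \<open>0 < k\<close>])
    then show ?thesis
      using finite_linear_order_embedding[OF rlin ball slin words words_finite] by simp
  qed
  then have "\<forall>z\<in>X'. \<exists>g. (\<forall>x\<in>X.mcball z m. g x div k = f' z) \<and>
      (\<forall>x\<in>X.mcball z m. \<forall>y\<in>X.mcball z m. (g x, g y) \<in> s \<longleftrightarrow> (x, y) \<in> r)"
    by blast
  from bchoice[OF this] obtain G where
    G: "\<And>z x. z \<in> X' \<Longrightarrow> x \<in> X.mcball z m \<Longrightarrow> G z x div k = f' z"
      "\<And>z x y. z \<in> X' \<Longrightarrow> x \<in> X.mcball z m \<Longrightarrow> y \<in> X.mcball z m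
        \<Longrightarrow> (G z x, G z y) \<in> s \<longleftrightarrow> (x, y) \<in> r"
    by blast

  define f where "f x = G (rep x) x" for x
  have rep_X': "rep x \<in> X'" if "x \<in> X" for x
    using that by (simp add: X'_def)
  have in_ball: "x \<in> X.mcball (rep x) m" if "x \<in> X" for x
    using that rep_X[OF that] rep_close[OF that] X.commute[of x "rep x"] by simp
  have f_div: "f x div k = f' (rep x)" if "x \<in> X" for x
    using G(1)[OF rep_X'[OF that] in_ball[OF that]] by (simp add: f_def)
  have f_in: "f x \<in> ?Y" if "x \<in> X" for x
    unfolding Y_iff f_div[OF that] by (rule f'_in[OF rep_X'[OF that]])
  have f'_inj: "z = w" if "z \<in> X'" "w \<in> X'" "f' z = f' w" for z w
    using f'_dist[OF that(1,2)] X'.zero[OF that(1,2)] that(3) by simp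
  have f_order: "(f x, f y) \<in> s \<longleftrightarrow> (x, y) \<in> r" if xy: "x \<in> X" "y \<in> X" for x y
  proof (cases "rep x = rep y")
    case True
    then show ?thesis
      using G(2)[OF rep_X'[OF xy(1)] in_ball[OF xy(1)], of y] in_ball[OF xy(2)]
      by (simp add: f_def)
  next
    \<comment> \<open>Points of two different balls are compared like the representatives of the balls, and
      words over two different prefixes like the words that extend them by the digit 0.\<close>
    case False
    let ?z = "rep x" and ?w = "rep y"
    have zw: "?z \<in> X'" "?w \<in> X'" and zw_Y: "f' ?z \<in> ?Y'" "f' ?w \<in> ?Y'" and "f' ?z \<noteq> f' ?w"
      using rep_X'[OF xy(1)] rep_X'[OF xy(2)] f'_in f'_inj False by blast+
    have centre: "rep u \<in> X.mcball (rep u) m" if "u \<in> X" for u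
      using rep_X[OF that] \<open>0 < m\<close> by simp
    have "(x, y) \<in> r \<longleftrightarrow> (?z, ?w) \<in> r"
    proof -
      have "X.mcball ?z m \<inter> X.mcball ?w m = {}"
      proof (rule ccontr)
        assume "X.mcball ?z m \<inter> X.mcball ?w m \<noteq> {}"
        then obtain u where "u \<in> X" "d ?z u \<le> m" "d ?w u \<le> m"
          by auto
        then have "d ?z ?w \<le> m"
          using X.ultrametric[of ?z u ?w] X.commute[of u ?w] rep_X[OF xy(1)] rep_X[OF xy(2)]
          by simp
        then have "d x y \<le> m"
          using rep_dist[OF xy False] by simp
        with False rep_eq[OF xy] show False by simp
      qed
      then show ?thesis
        using order_between_convex_sets[OF rlin rball[OF rep_X[OF xy(1)]] rball[OF rep_X[OF xy(2)]]
            X.mcball_subset_mspace X.mcball_subset_mspace]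
          in_ball[OF xy(1)] in_ball[OF xy(2)] centre[OF xy(1)] centre[OF xy(2)]
        by blast
    qed
    also have "\<dots> \<longleftrightarrow> (f' ?z, f' ?w) \<in> s'"
      using f'_order[OF zw] zw by (simp add: r'_def)
    also have "\<dots> \<longleftrightarrow> (f' ?z * k, f' ?w * k) \<in> s"
      using zw_Y by (simp add: s'_def)
    also have "\<dots> \<longleftrightarrow> (f x, f y) \<in> s"
    proof -
      let ?F = "\<lambda>p. {q. q div k = p}"
      have conv: "order_convex_in ?Y s (?F p)" and sub: "?F p \<subseteq> ?Y" if "p \<in> ?Y'" for p
      proof -
        have "p * k \<in> ?Y"
          unfolding Y_iff using that \<open>0 < k\<close> by simp
        then show "order_convex_in ?Y s (?F p)" "?F p \<subseteq> ?Y"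
          using sball[of "p * k"] fibre[OF that] Y.mcball_subset_mspace[of "p * k" m] by simp_all
      qed
      have "?F (f' ?z) \<inter> ?F (f' ?w) = {}"
        using \<open>f' ?z \<noteq> f' ?w\<close> by auto
      moreover have "f x \<in> ?F (f' ?z)" "f' ?z * k \<in> ?F (f' ?z)"
        "f y \<in> ?F (f' ?w)" "f' ?w * k \<in> ?F (f' ?w)"
        using f_div[OF xy(1)] f_div[OF xy(2)] \<open>0 < k\<close> by simp_all
      ultimately show ?thesis
        using order_between_convex_sets[OF slin conv conv sub sub, OF zw_Y zw_Y] by blast
    qed
    finally show ?thesis by simp
  qed
  have f_inj: "x = y" if xy: "x \<in> X" "y \<in> X" "f x = f y" for x y
  proof -
    have "(f x, f x) \<in> s"
      using linear_order_on_linear[OF slin f_in f_in, OF xy(1,1)] by simp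
    then have "(x, y) \<in> r" "(y, x) \<in> r"
      using f_order[OF xy(1,2)] f_order[OF xy(2,1)] xy(3) by simp_all
    then show ?thesis
      using rlin by (auto simp: order_on_defs dest: antisymD)
  qed
  have f_dist: "?e (f x) (f y) = d x y" if xy: "x \<in> X" "y \<in> X" for x y
  proof (cases "x = y")
    case True
    with xy show ?thesis by simp
  next
    case neq: False
    then have "f x \<noteq> f y"
      using f_inj xy by blast
    show ?thesis
    proof (cases "rep x = rep y")
      case True
      then have "d x y \<le> m"
        using rep_eq xy by simp
      with dist[OF xy neq] have "d x y = m"
        using m_less[of "d x y"] by auto
      with True \<open>f x \<noteq> f y\<close> show ?thesis
        by (simp add: f_div[OF xy(1)] f_div[OF xy(2)])
    next
      case False
      then have "f' (rep x) \<noteq> f' (rep y)"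
        using f'_inj rep_X' xy by blast
      with \<open>f x \<noteq> f y\<close> show ?thesis
        using f'_dist[OF rep_X'[OF xy(1)] rep_X'[OF xy(2)]] rep_dist[OF xy False]
        by (simp add: f_div[OF xy(1)] f_div[OF xy(2)])
    qed
  qed
  show ?case
    unfolding ordered_isometric_embedding_def using f_in f_dist f_order by blast
qed

theorem theorem18:
  fixes S :: "real set"
    and X :: "'a set"
    and dX :: "'a \<Rightarrow> 'a \<Rightarrow> real"
  assumes "S \<subseteq> {0<..}"
    and "finite_ultrametric_with_distances_in S X dX"
  shows "\<exists>(Y :: nat set) dY.
           finite_ultrametric_with_distances_in S Y dY \<and>
           (\<forall>rX rY. convex_linear_order_on X dX rX \<longrightarrow> convex_linear_order_on Y dY rY \<longrightarrow>
              (\<exists>f. ordered_isometric_embedding X dX rX Y dY rY f))"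
proof -
  define D where "D = {dX x y | x y. x \<in> X \<and> y \<in> X \<and> x \<noteq> y}"
  define ms where "ms = sorted_list_of_set D"
  \<comment> \<open>The successor keeps the base positive when \<open>X\<close> is empty.\<close>
  define k where "k = Suc (card X)"
  have "finite X" and "D \<subseteq> S"
    using assms(2) by (auto simp: finite_ultrametric_with_distances_in_def D_def)
  have "D \<subseteq> (\<lambda>(x, y). dX x y) ` (X \<times> X)"
    by (auto simp: D_def)
  then have "finite D"
    using \<open>finite X\<close> by (simp add: finite_subset)
  then have set_ms: "set ms = D" and sorted: "sorted_wrt (<) ms"
    unfolding ms_def by simp_all
  have pos: "\<forall>m\<in>set ms. 0 < m"
    using assms(1) \<open>D \<subseteq> S\<close> set_ms by auto
  have "0 < k" "card X \<le> k"
    by (simp_all add: k_def)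
  have X: "finite_ultrametric_with_distances_in (set ms) X dX"
    using assms(2) by (auto simp: finite_ultrametric_with_distances_in_def set_ms D_def)
  have "finite_ultrametric_with_distances_in S {..<k ^ length ms} (digit_dist k ms)"
    using Ultrametric_space_digit_dist[OF \<open>0 < k\<close> sorted pos] digit_dist_in_set[OF \<open>0 < k\<close>, of _ ms]
      set_ms \<open>D \<subseteq> S\<close>
    by (auto simp: finite_ultrametric_with_distances_in_def)
  then show ?thesis
    using universal_ordered_embedding[OF \<open>0 < k\<close> sorted pos X \<open>card X \<le> k\<close>] by blast
qed

end
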